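(* Let $n\ge1$. There are maps $$\bullet:\mathrm{P}\mathrm{P}[n,\widetilde n]\times\mathrm{P}\mathrm{P}[n,\widetilde n]\to\mathrm{P}\mathrm{P}[n,\widetilde n]\qquad\text{and}\qquad\bullet:\mathrm{P}\mathrm{P}[n,\widetilde n]\times\mathrm{P}\mathrm{P}[n]\to\mathrm{P}\mathrm{P}[n]$$ such that the pair $(\mathrm{P}\mathrm{P}[n,\widetilde n],\mathrm{P}\mathrm{P}[n])$ (a $\mathbb{Z}_2$-algebra and a module over it, with these products) is isomorphic to $\left(\mathrm{End}_{\mathbb{Z}_2}(\mathrm{M}(\mathbb{Z}_2^n,\mathbb{Z}_2)),\mathrm{M}(\mathbb{Z}_2^n,\mathbb{Z}_2)\right)$ via the maps $$A\mapsto\sum_{a\in A}x^{a_1}\partial^{a_2}\qquad\text{and}\qquad F\mapsto\sum_{a\in F}x^a.$$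
   Context: $\mathbb{Z}_2=\{0,1\}$ is the field with two elements, $[n]=\{1,\dots,n\}$, $\mathrm{P}(y)$ is the set of subsets of $y$, and $\mathrm{P}\mathrm{P}(y)=\mathrm{P}(\mathrm{P}(y))$. $[n,\widetilde n]=\{1,\dots,n,\widetilde1,\dots,\widetilde n\}$ is the disjoint union of two copies of $[n]$; for $a\subseteq[n]$, $\widetilde a=\{\widetilde i\mid i\in a\}$. Each $a\in\mathrm{P}[n,\widetilde n]$ is written uniquely as $a=a_1\sqcup\widetilde a_2$ with $a_1,a_2\in\mathrm{P}[n]$. The additive structure on $\mathrm{P}\mathrm{P}[n,\widetilde n]$ and on $\mathrm{P}\mathrm{P}[n]$ is the symmetric difference $A+B=(A\cup B)\setminus(A\cap B)$. $\mathrm{M}(\mathbb{Z}_2^n,\mathbb{Z}_2)$ is the $\mathbb{Z}_2$-algebra of all maps $\mathbb{Z}_2^n\to\mathbb{Z}_2$; it is a module over its algebra of $\mathbb{Z}_2$-linear endomorphisms $\mathrm{End}_{\mathbb{Z}_2}(\mathrm{M}(\mathbb{Z}_2^n,\mathbb{Z}_2))$ by evaluation. For $a\in\mathrm{P}[n]$, $x^a=\prod_{i\in a}x_i$ is the product of coordinate functions ($x^\emptyset=1$), also viewed as the operator of multiplication by it; $\partial^a=\prod_{i\in a}\partial_i$ where $\partial_if(x)=f(x+e_i)+f(x)$ and $e_i$ is the vector whose only nonzero entry is at position $i$. Pairs $(A,M)$ consist of a $\mathbb{Z}_2$-algebra $A$ and an $A$-module $M$; a morphism $(f,g):(A_1,M_1)\to(A_2,M_2)$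 consists of $\mathbb{Z}_2$-linear maps $f:A_1\to A_2$, $g:M_1\to M_2$ with $f$ an algebra morphism and $g(am)=f(a)g(m)$. *)

theory Defs
  imports
    "HOL-Analysis.Finite_Cartesian_Product"
    "HOL-Algebra.Algebraic_Closure_Type"
    "HOL-Library.Z2"
begin

text \<open>
  The locale \<^locale>\<open>algebra\<close> of HOL-Algebra requires commutative multiplication, so it
  does not cover endomorphism algebras; the following is its noncommutative (associative, unital)
  version.
\<close>

locale assoc_algebra = module K A + ring A for K (structure) and A (structure) +
  assumes smult_mult_left:
      "\<lbrakk>k \<in> carrier K; x \<in> carrier A; y \<in> carrier A\<rbrakk> \<Longrightarrow>
       (k \<odot>\<^bsub>A\<^esub> x) \<otimes>\<^bsub>A\<^esub> y = k \<odot>\<^bsub>A\<^esub> (x \<otimes>\<^bsub>A\<^esub> y)"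
    and smult_mult_right:
      "\<lbrakk>k \<in> carrier K; x \<in> carrier A; y \<in> carrier A\<rbrakk> \<Longrightarrow>
       x \<otimes>\<^bsub>A\<^esub> (k \<odot>\<^bsub>A\<^esub> y) = k \<odot>\<^bsub>A\<^esub> (x \<otimes>\<^bsub>A\<^esub> y)"

text \<open>
  A pair consisting of a \<open>K\<close>-algebra \<open>A\<close> and an \<open>A\<close>-module \<open>M\<close>. The record \<open>M\<close> only carries the
  \<open>K\<close>-linear structure; the action of \<open>A\<close> is the separate parameter \<open>act\<close>. The \<open>mult\<close> and \<open>one\<close>
  fields of \<open>M\<close> play no role.
\<close>

locale algebra_module = A: assoc_algebra K A + M: module K M
  for K (structure) and A (structure) and M (structure)
    and act :: "'b \<Rightarrow> 'c \<Rightarrow> 'c" +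
  constrains A :: "('a, 'b) module" and M :: "('a, 'c) module"
  assumes act_closed:
      "\<lbrakk>a \<in> carrier A; m \<in> carrier M\<rbrakk> \<Longrightarrow> act a m \<in> carrier M"
    and act_add_left:
      "\<lbrakk>a \<in> carrier A; b \<in> carrier A; m \<in> carrier M\<rbrakk> \<Longrightarrow>
       act (a \<oplus>\<^bsub>A\<^esub> b) m = act a m \<oplus>\<^bsub>M\<^esub> act b m"
    and act_add_right:
      "\<lbrakk>a \<in> carrier A; m \<in> carrier M; m' \<in> carrier M\<rbrakk> \<Longrightarrow>
       act a (m \<oplus>\<^bsub>M\<^esub> m') = act a m \<oplus>\<^bsub>M\<^esub> act a m'"
    and act_smult_left:
      "\<lbrakk>k \<in> carrier K; a \<in> carrier A; m \<in> carrier M\<rbrakk> \<Longrightarrow>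
       act (k \<odot>\<^bsub>A\<^esub> a) m = k \<odot>\<^bsub>M\<^esub> act a m"
    and act_smult_right:
      "\<lbrakk>k \<in> carrier K; a \<in> carrier A; m \<in> carrier M\<rbrakk> \<Longrightarrow>
       act a (k \<odot>\<^bsub>M\<^esub> m) = k \<odot>\<^bsub>M\<^esub> act a m"
    and act_mult:
      "\<lbrakk>a \<in> carrier A; b \<in> carrier A; m \<in> carrier M\<rbrakk> \<Longrightarrow>
       act (a \<otimes>\<^bsub>A\<^esub> b) m = act a (act b m)"
    and act_one:
      "m \<in> carrier M \<Longrightarrow> act \<one>\<^bsub>A\<^esub> m = m"

definition linear_maps :: "'k ring \<Rightarrow> ('k, 'v) module \<Rightarrow> ('k, 'w) module \<Rightarrow> ('v \<Rightarrow> 'w) set" where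
  "linear_maps K V W =
     {h \<in> carrier V \<rightarrow> carrier W.
        (\<forall>x\<in>carrier V. \<forall>y\<in>carrier V. h (x \<oplus>\<^bsub>V\<^esub> y) = h x \<oplus>\<^bsub>W\<^esub> h y) \<and>
        (\<forall>k\<in>carrier K. \<forall>x\<in>carrier V. h (k \<odot>\<^bsub>V\<^esub> x) = k \<odot>\<^bsub>W\<^esub> h x)}"

definition pair_morphism ::
    "'k ring \<Rightarrow> ('k, 'a) module \<Rightarrow> ('k, 'm) module \<Rightarrow> ('a \<Rightarrow> 'm \<Rightarrow> 'm) \<Rightarrow>
     ('k, 'b) module \<Rightarrow> ('k, 'n) module \<Rightarrow> ('b \<Rightarrow> 'n \<Rightarrow> 'n) \<Rightarrow> ('a \<Rightarrow> 'b) \<Rightarrow> ('m \<Rightarrow> 'n) \<Rightarrow> bool"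
  where
  "pair_morphism K A1 M1 act1 A2 M2 act2 f g \<longleftrightarrow>
     f \<in> linear_maps K A1 A2 \<and> f \<in> ring_hom A1 A2 \<and>
     g \<in> linear_maps K M1 M2 \<and>
     (\<forall>a\<in>carrier A1. \<forall>m\<in>carrier M1. g (act1 a m) = act2 (f a) (g m))"

definition pair_isomorphism ::
    "'k ring \<Rightarrow> ('k, 'a) module \<Rightarrow> ('k, 'm) module \<Rightarrow> ('a \<Rightarrow> 'm \<Rightarrow> 'm) \<Rightarrow>
     ('k, 'b) module \<Rightarrow> ('k, 'n) module \<Rightarrow> ('b \<Rightarrow> 'n \<Rightarrow> 'n) \<Rightarrow> ('a \<Rightarrow> 'b) \<Rightarrow> ('m \<Rightarrow> 'n) \<Rightarrow> bool"
  where
  "pair_isomorphism K A1 M1 act1 A2 M2 act2 f g \<longleftrightarrow>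
     pair_morphism K A1 M1 act1 A2 M2 act2 f g \<and>
     bij_betw f (carrier A1) (carrier A2) \<and> bij_betw g (carrier M1) (carrier M2)"

text \<open>Endomorphisms are represented by functions that are \<open>undefined\<close> outside the carrier.\<close>

definition endo_algebra :: "'k ring \<Rightarrow> ('k, 'v) module \<Rightarrow> ('k, 'v \<Rightarrow> 'v) module" where
  "endo_algebra K V =
     \<lparr>carrier = linear_maps K V V \<inter> extensional (carrier V),
      monoid.mult = (\<lambda>S T. compose (carrier V) S T),
      monoid.one = (\<lambda>v\<in>carrier V. v),
      ring.zero = (\<lambda>v\<in>carrier V. \<zero>\<^bsub>V\<^esub>),
      ring.add = (\<lambda>S T. \<lambda>v\<in>carrier V. S v \<oplus>\<^bsub>V\<^esub> T v),
      module.smult = (\<lambda>k T. \<lambda>v\<in>carrier V. k \<odot>\<^bsub>V\<^esub> T v)\<rparr>"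

lemma algebra_module_endo_algebra:
  assumes "module K V"
  shows "algebra_module K (endo_algebra K V) V (\<lambda>T v. T v)"
proof -
  interpret module K V by fact
  let ?E = "endo_algebra K V"
  have E: "T \<in> carrier ?E \<longleftrightarrow> T \<in> linear_maps K V V \<and> T \<in> extensional (carrier V)" for T
    by (simp add: endo_algebra_def)
  have cl [simp]: "T v \<in> carrier V" if "T \<in> carrier ?E" "v \<in> carrier V" for T v
    using that unfolding E linear_maps_def by blast
  have ad [simp]: "T (v \<oplus>\<^bsub>V\<^esub> w) = T v \<oplus>\<^bsub>V\<^esub> T w"
    if "T \<in> carrier ?E" "v \<in> carrier V" "w \<in> carrier V" for T v w
    using that unfolding E linear_maps_def by blast
  have sm [simp]: "T (k \<odot>\<^bsub>V\<^esub> v) = k \<odot>\<^bsub>V\<^esub> T v"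
    if "T \<in> carrier ?E" "k \<in> carrier K" "v \<in> carrier V" for T k v
    using that unfolding E linear_maps_def by blast
  have inE: "(\<lambda>v\<in>carrier V. h v) \<in> carrier ?E"
    if "\<And>v. v \<in> carrier V \<Longrightarrow> h v \<in> carrier V"
      "\<And>v w. v \<in> carrier V \<Longrightarrow> w \<in> carrier V \<Longrightarrow> h (v \<oplus>\<^bsub>V\<^esub> w) = h v \<oplus>\<^bsub>V\<^esub> h w"
      "\<And>k v. k \<in> carrier K \<Longrightarrow> v \<in> carrier V \<Longrightarrow> h (k \<odot>\<^bsub>V\<^esub> v) = k \<odot>\<^bsub>V\<^esub> h v" for h
    unfolding E linear_maps_def by (simp add: that)
  have eqE: "S = T" if "S \<in> carrier ?E" "T \<in> carrier ?E" "\<And>v. v \<in> carrier V \<Longrightarrow> S v = T v" for S T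
    by (rule extensionalityI[of _ "carrier V"]) (use that E in blast)+
  have one: "\<one>\<^bsub>?E\<^esub> = (\<lambda>v\<in>carrier V. v)" and zero: "\<zero>\<^bsub>?E\<^esub> = (\<lambda>v\<in>carrier V. \<zero>\<^bsub>V\<^esub>)"
    and add: "\<And>S T. S \<oplus>\<^bsub>?E\<^esub> T = (\<lambda>v\<in>carrier V. S v \<oplus>\<^bsub>V\<^esub> T v)"
    and mult: "\<And>S T. S \<otimes>\<^bsub>?E\<^esub> T = (\<lambda>v\<in>carrier V. S (T v))"
    and smult: "\<And>k T. k \<odot>\<^bsub>?E\<^esub> T = (\<lambda>v\<in>carrier V. k \<odot>\<^bsub>V\<^esub> T v)"
    by (simp_all add: endo_algebra_def compose_def)
  have one_closed [simp]: "\<one>\<^bsub>?E\<^esub> \<in> carrier ?E"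
    unfolding one by (rule inE) auto
  have zero_closed [simp]: "\<zero>\<^bsub>?E\<^esub> \<in> carrier ?E"
    unfolding zero by (rule inE) auto
  have add_closed [simp]: "S \<oplus>\<^bsub>?E\<^esub> T \<in> carrier ?E" if "S \<in> carrier ?E" "T \<in> carrier ?E" for S T
    unfolding add using that by (intro inE) (auto simp: M.a_ac smult_r_distr)
  have mult_closed [simp]: "S \<otimes>\<^bsub>?E\<^esub> T \<in> carrier ?E" if "S \<in> carrier ?E" "T \<in> carrier ?E" for S T
    unfolding mult using that by (intro inE) auto
  have smult_comm: "k \<odot>\<^bsub>V\<^esub> (l \<odot>\<^bsub>V\<^esub> v) = l \<odot>\<^bsub>V\<^esub> (k \<odot>\<^bsub>V\<^esub> v)"
    if "k \<in> carrier K" "l \<in> carrier K" "v \<in> carrier V" for k l v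
    using that by (metis smult_assoc1 R.m_comm)
  have smult_cl [simp]: "k \<odot>\<^bsub>?E\<^esub> T \<in> carrier ?E" if "k \<in> carrier K" "T \<in> carrier ?E" for k T
    unfolding smult using that by (intro inE) (auto simp: smult_r_distr intro: smult_comm)
  have neg_closed: "(\<lambda>v\<in>carrier V. \<ominus>\<^bsub>V\<^esub> T v) \<in> carrier ?E" if "T \<in> carrier ?E" for T
    using that by (intro inE) (auto simp: M.minus_add smult_r_minus)
  have app: "\<one>\<^bsub>?E\<^esub> v = v" "\<zero>\<^bsub>?E\<^esub> v = \<zero>\<^bsub>V\<^esub>" "(S \<oplus>\<^bsub>?E\<^esub> T) v = S v \<oplus>\<^bsub>V\<^esub> T v"
    "(S \<otimes>\<^bsub>?E\<^esub> T) v = S (T v)" "(k \<odot>\<^bsub>?E\<^esub> T) v = k \<odot>\<^bsub>V\<^esub> T v" if "v \<in> carrier V" for S T k v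
    using that by (simp_all add: one zero add mult smult)
  have ag: "abelian_group ?E"
  proof (rule abelian_groupI)
    show "\<exists>S\<in>carrier ?E. S \<oplus>\<^bsub>?E\<^esub> T = \<zero>\<^bsub>?E\<^esub>" if "T \<in> carrier ?E" for T
    proof (rule bexI[OF _ neg_closed[OF that]])
      show "(\<lambda>v\<in>carrier V. \<ominus>\<^bsub>V\<^esub> T v) \<oplus>\<^bsub>?E\<^esub> T = \<zero>\<^bsub>?E\<^esub>"
        by (rule eqE) (simp_all add: that neg_closed app M.l_neg)
    qed
  qed (auto intro!: eqE simp: app M.a_ac)
  have mo: "Group.monoid ?E"
    by (rule monoidI) (auto intro!: eqE simp: app)
  have ri: "ring ?E"
    by (rule ringI[OF ag mo]) (auto intro!: eqE simp: app)
  have md: "module K ?E"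
    by (rule moduleI[OF R.is_cring ag])
       (auto intro!: eqE simp: app smult_l_distr smult_r_distr smult_assoc1)
  show ?thesis
    by (intro algebra_module.intro assoc_algebra.intro assoc_algebra_axioms.intro
          algebra_module_axioms.intro md ri assms)
       (auto intro!: eqE simp: app)
qed

abbreviation Z2 :: "bit ring" where
  "Z2 \<equiv> ring_of_type_algebra"

text \<open>
  The coordinates of $\mathbb{Z}_2^n$ are indexed by a finite type \<open>'n\<close> playing the role of
  $\{1,\dots,n\}$.
\<close>

definition maps_algebra :: "(bit, bit ^ 'n \<Rightarrow> bit) module" where
  "maps_algebra =
     \<lparr>carrier = UNIV,
      monoid.mult = (\<lambda>f g x. f x * g x), monoid.one = (\<lambda>x. 1),
      ring.zero = (\<lambda>x. 0), ring.add = (\<lambda>f g x. f x + g x),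
      module.smult = (\<lambda>k f x. k * f x)\<rparr>"

abbreviation End_maps :: "(bit, (bit ^ 'n \<Rightarrow> bit) \<Rightarrow> (bit ^ 'n \<Rightarrow> bit)) module" where
  "End_maps \<equiv> endo_algebra Z2 maps_algebra"

definition monom_fun :: "('n::finite) set \<Rightarrow> bit ^ 'n \<Rightarrow> bit" where
  "monom_fun a = (\<lambda>x. \<Prod>i\<in>a. vec_nth x i)"

definition monom_op :: "('n::finite) set \<Rightarrow> (bit ^ 'n \<Rightarrow> bit) \<Rightarrow> (bit ^ 'n \<Rightarrow> bit)" where
  "monom_op a = (\<lambda>f. monom_fun a \<otimes>\<^bsub>maps_algebra\<^esub> f)"

definition partial_diff :: "'n::finite \<Rightarrow> (bit ^ 'n \<Rightarrow> bit) \<Rightarrow> (bit ^ 'n \<Rightarrow> bit)" where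
  "partial_diff i f = (\<lambda>x. f (x + axis i 1) + f x)"

text \<open>
  The product of the operators \<open>partial_diff i\<close> over \<open>i \<in> a\<close>. Since the ambient endomorphism algebra
  is not commutative, \<^const>\<open>finprod\<close> is not available; the fold is independent of the order
  because these operators commute.
\<close>

definition partial_diffs :: "('n::finite) set \<Rightarrow> (bit ^ 'n \<Rightarrow> bit) \<Rightarrow> (bit ^ 'n \<Rightarrow> bit)" where
  "partial_diffs a f = Finite_Set.fold partial_diff f a"

lemma comp_fun_commute_partial_diff: "comp_fun_commute partial_diff"
proof
  fix i j :: "'n::finite"
  show "partial_diff i \<circ> partial_diff j = partial_diff j \<circ> partial_diff i"
    by (rule ext)+ (simp add: partial_diff_def ac_simps del: add_bit_eq_xor mult_bit_eq_and)
qed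

lemma partial_diffs_empty [simp]: "partial_diffs {} f = f"
  by (simp add: partial_diffs_def)

lemma partial_diffs_insert:
  fixes i :: "'n::finite"
  assumes "i \<notin> a"
  shows "partial_diffs (insert i a) f = partial_diff i (partial_diffs a f)"
proof -
  interpret comp_fun_commute "partial_diff :: 'n \<Rightarrow> _" by (rule comp_fun_commute_partial_diff)
  show ?thesis using assms by (simp add: partial_diffs_def)
qed

lemma monom_op_in_End: "monom_op a \<in> carrier End_maps"
  by (simp add: endo_algebra_def linear_maps_def monom_op_def maps_algebra_def
      distrib_left mult.left_commute
      del: add_bit_eq_xor mult_bit_eq_and)

lemma partial_diffs_in_End: "partial_diffs a \<in> carrier End_maps"
proof -
  have add: "partial_diffs a (\<lambda>x. f x + g x) = (\<lambda>x. partial_diffs a f x + partial_diffs a g x)"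
    for f g
    by (induction a rule: finite_induct[OF finite])
       (simp_all add: partial_diffs_insert partial_diff_def add.assoc add.left_commute
          del: add_bit_eq_xor mult_bit_eq_and)
  have smult: "partial_diffs a (\<lambda>x. k * f x) = (\<lambda>x. k * partial_diffs a f x)" for k f
    by (induction a rule: finite_induct[OF finite])
       (simp_all add: partial_diffs_insert partial_diff_def distrib_left
          del: add_bit_eq_xor mult_bit_eq_and)
  show ?thesis
    by (simp add: endo_algebra_def linear_maps_def maps_algebra_def add smult del: add_bit_eq_xor mult_bit_eq_and)
qed

lemma module_maps_algebra: "module Z2 maps_algebra"
proof (rule moduleI)
  show "cring Z2" by (rule cring_from_type_algebra)
  show "abelian_group maps_algebra"
  proof (rule abelian_groupI)
    fix f :: "bit ^ 'n \<Rightarrow> bit"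
    show "\<exists>g\<in>carrier maps_algebra. g \<oplus>\<^bsub>maps_algebra\<^esub> f = \<zero>\<^bsub>maps_algebra\<^esub>"
      by (rule bexI[of _ f]) (auto simp: maps_algebra_def fun_eq_iff)
  qed (simp_all add: maps_algebra_def add.assoc add.commute add.left_commute
      del: add_bit_eq_xor mult_bit_eq_and)
qed (simp_all add: maps_algebra_def ring_of_type_algebra_def distrib_left distrib_right
      mult.assoc del: add_bit_eq_xor mult_bit_eq_and)

lemma algebra_module_End_maps: "algebra_module Z2 End_maps maps_algebra (\<lambda>T f. T f)"
  by (rule algebra_module_endo_algebra[OF module_maps_algebra])

text \<open>
  The \<open>\<int>\<^sub>2\<close>-vector space of families of subsets of \<open>'a\<close> under symmetric difference. It comes without
  a multiplication.
\<close>

definition PP_space :: "(bit, 'a set set) module" where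
  "PP_space =
     \<lparr>carrier = UNIV,
      monoid.mult = undefined, monoid.one = undefined,
      ring.zero = {}, ring.add = (\<lambda>A B. (A \<union> B) - (A \<inter> B)),
      module.smult = (\<lambda>k A. if k = 0 then {} else A)\<rparr>"

definition PP_algebra ::
    "('a set set \<Rightarrow> 'a set set \<Rightarrow> 'a set set) \<Rightarrow> 'a set set \<Rightarrow> (bit, 'a set set) module" where
  "PP_algebra prd u = PP_space\<lparr>monoid.mult := prd, monoid.one := u\<rparr>"

text \<open>
  The disjoint union $[n,\widetilde n]$ is the type \<open>'n + 'n\<close>; the two components of a subset \<open>a\<close>
  are its preimages under \<^const>\<open>Inl\<close> and \<^const>\<open>Inr\<close>.
\<close>

definition operator_of ::
    "('n::finite + 'n) set set \<Rightarrow> (bit ^ 'n \<Rightarrow> bit) \<Rightarrow> (bit ^ 'n \<Rightarrow> bit)" where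
  "operator_of A =
     (\<Oplus>\<^bsub>End_maps\<^esub>a\<in>A. monom_op (Inl -` a) \<otimes>\<^bsub>End_maps\<^esub> partial_diffs (Inr -` a))"

definition map_of_family :: "('n::finite) set set \<Rightarrow> bit ^ 'n \<Rightarrow> bit" where
  "map_of_family F = (\<Oplus>\<^bsub>maps_algebra\<^esub>a\<in>F. monom_fun a)"

end

theory Submission
  imports Defs
begin

text \<open>
  The products on families of sets are the composition and evaluation of operators, transported
  along the two given maps; everything therefore rests on these maps being linear bijections. Both
  are additive because multiplicities of monomials are counted modulo two, which is exactly symmetric
  difference (\<open>sum_bit_symm_diff\<close>). Injectivity is then a statement about kernels, and surjectivity
  follows by counting.

  For functions: if \<open>F\<close> is nonempty and \<open>c\<close> is minimal in \<open>F\<close>, then of all the monomials \<open>x\<^sup>a\<close> with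
  \<open>a \<in> F\<close> only \<open>x\<^sup>c\<close> does not vanish at the indicator vector of \<open>c\<close>, so the sum is nonzero. As there
  are $2^{2^n}$ families and as many functions, every function is a unique sum of monomials.

  For operators: \<open>\<partial>\<^sup>c x\<^sup>b\<close> is \<open>x\<close> to the power \<open>b - c\<close> if \<open>c \<subseteq> b\<close>, and zero otherwise
  (\<open>partial_diffs_monom_fun\<close>). Given a nonempty \<open>A\<close>, let \<open>c\<close> be minimal among the derivative parts of
  its members and apply the operator of \<open>A\<close> to \<open>x\<^sup>c\<close>: what survives is the sum of the \<open>x\<close>-parts of the
  members whose derivative part is exactly \<open>c\<close>, a nonempty sum of distinct monomials, hence not
  zero. For surjectivity, an endomorphism is determined by its values on the $2^n$ monomials, so
  there are at most $(2^{2^n})^{2^n} = 2^{2^{2n}}$ of them, the number of families \<open>A\<close>.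
\<close>

section \<open>Transport of structure\<close>

text \<open>
  The axioms relating product, action and linear structure are equations, so they can be checked
  after applying injective maps which respect all operations.
\<close>

lemma algebra_module_transport:
  assumes "algebra_module K A2 M2 act2" and A1: "module K A1" and M1: "module K M1"
    and f: "f \<in> linear_maps K A1 A2" "inj_on f (carrier A1)"
    and g: "g \<in> linear_maps K M1 M2" "inj_on g (carrier M1)"
    and mult: "\<And>a b. \<lbrakk>a \<in> carrier A1; b \<in> carrier A1\<rbrakk> \<Longrightarrow>
      a \<otimes>\<^bsub>A1\<^esub> b \<in> carrier A1 \<and> f (a \<otimes>\<^bsub>A1\<^esub> b) = f a \<otimes>\<^bsub>A2\<^esub> f b"
    and one: "\<one>\<^bsub>A1\<^esub> \<in> carrier A1" "f \<one>\<^bsub>A1\<^esub> = \<one>\<^bsub>A2\<^esub>"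
    and act: "\<And>a m. \<lbrakk>a \<in> carrier A1; m \<in> carrier M1\<rbrakk> \<Longrightarrow>
      act1 a m \<in> carrier M1 \<and> g (act1 a m) = act2 (f a) (g m)"
  shows "algebra_module K A1 M1 act1"
proof -
  interpret T: algebra_module K A2 M2 act2 by fact
  interpret A1: module K A1 by fact
  interpret M1: module K M1 by fact
  have fc [simp]: "f a \<in> carrier A2" if "a \<in> carrier A1" for a
    using f that by (auto simp: linear_maps_def)
  have gc [simp]: "g a \<in> carrier M2" if "a \<in> carrier M1" for a
    using g that by (auto simp: linear_maps_def)
  have fl [simp]: "f (a \<oplus>\<^bsub>A1\<^esub> b) = f a \<oplus>\<^bsub>A2\<^esub> f b" if "a \<in> carrier A1" "b \<in> carrier A1" for a b
    using f that by (auto simp: linear_maps_def)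
  have gl [simp]: "g (a \<oplus>\<^bsub>M1\<^esub> b) = g a \<oplus>\<^bsub>M2\<^esub> g b" if "a \<in> carrier M1" "b \<in> carrier M1" for a b
    using g that by (auto simp: linear_maps_def)
  have fs [simp]: "f (k \<odot>\<^bsub>A1\<^esub> b) = k \<odot>\<^bsub>A2\<^esub> f b" if "k \<in> carrier K" "b \<in> carrier A1" for k b
    using f that by (auto simp: linear_maps_def)
  have gs [simp]: "g (k \<odot>\<^bsub>M1\<^esub> b) = k \<odot>\<^bsub>M2\<^esub> g b" if "k \<in> carrier K" "b \<in> carrier M1" for k b
    using g that by (auto simp: linear_maps_def)
  note [simp] = mult[THEN conjunct1] mult[THEN conjunct2] act[THEN conjunct1]
    act[THEN conjunct2] one
  note fI = inj_onD[OF f(2)] and gI = inj_onD[OF g(2)]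
  have mon: "Group.monoid A1"
    by (rule monoidI) (auto intro!: fI simp: T.A.m_assoc)
  have ri: "ring A1"
    by (rule ringI[OF A1.abelian_group_axioms mon])
      (auto intro!: fI simp: T.A.l_distr T.A.r_distr)
  show ?thesis
    by (intro algebra_module.intro assoc_algebra.intro assoc_algebra_axioms.intro
          algebra_module_axioms.intro A1 M1 ri)
      (auto intro!: fI gI simp: T.A.smult_mult_left T.A.smult_mult_right
        T.act_add_left T.act_add_right T.act_smult_left T.act_smult_right T.act_mult T.act_one)
qed

section \<open>Families of sets as a vector space\<close>

lemma cring_Z2: "cring Z2"
  by (rule cring_from_type_algebra)

lemma module_PP_algebra: "module Z2 (PP_algebra prd u)"
proof (rule moduleI[OF cring_Z2])
  show "abelian_group (PP_algebra prd u)"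
  proof (rule abelian_groupI)
    fix A :: "'a set set"
    show "\<exists>B\<in>carrier (PP_algebra prd u). B \<oplus>\<^bsub>PP_algebra prd u\<^esub> A = \<zero>\<^bsub>PP_algebra prd u\<^esub>"
      by (rule bexI[of _ A]) (auto simp: PP_algebra_def PP_space_def)
  qed (auto simp: PP_algebra_def PP_space_def)
qed (auto simp: PP_algebra_def PP_space_def ring_of_type_algebra_def)

lemma PP_space_eq: "PP_space = PP_algebra undefined undefined"
  by (simp add: PP_algebra_def PP_space_def)

text \<open>The common part of two families is summed twice and cancels in characteristic two.\<close>

lemma sum_bit_symm_diff:
  fixes f :: "'a \<Rightarrow> bit"
  assumes "finite A" "finite B"
  shows "sum f (A \<union> B - A \<inter> B) = sum f A + sum f B"
proof -
  have d: "A \<union> B - A \<inter> B = (A - B) \<union> (B - A)" by auto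
  have "sum f (A \<union> B - A \<inter> B) = sum f (A - B) + sum f (B - A)"
    unfolding d using assms by (intro sum.union_disjoint) auto
  moreover have "sum f A = sum f (A \<inter> B) + sum f (A - B)"
    using assms(1) by (rule sum.Int_Diff)
  moreover have "sum f B = sum f (A \<inter> B) + sum f (B - A)"
    using sum.Int_Diff[OF assms(2), of f A] by (simp add: Int_commute)
  moreover have "(x + y) + (x + z) = y + z" for x y z :: bit
    by (cases x; cases y; cases z) simp_all
  ultimately show ?thesis by simp
qed

section \<open>Functions as sums of monomials\<close>

lemma map_of_family_eq:
  fixes F :: "'n::finite set set"
  shows "map_of_family F x = (\<Sum>a\<in>F. monom_fun a x)"
proof -
  interpret module Z2 "maps_algebra :: (bit, bit ^ 'n \<Rightarrow> bit) module"
    by (rule module_maps_algebra)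
  have carr: "f \<in> carrier maps_algebra" for f :: "bit ^ 'n \<Rightarrow> bit"
    by (simp add: maps_algebra_def)
  have zero: "\<zero>\<^bsub>maps_algebra\<^esub> x = 0" for x :: "bit ^ 'n"
    by (simp add: maps_algebra_def)
  have add: "(f \<oplus>\<^bsub>maps_algebra\<^esub> g) x = f x + g x" for f g and x :: "bit ^ 'n"
    by (simp add: maps_algebra_def)
  have "finite F" by simp
  then have "(\<Oplus>\<^bsub>maps_algebra\<^esub>a\<in>F. monom_fun a) x = (\<Sum>a\<in>F. monom_fun a x)"
  proof (induction F)
    case empty
    show ?case by (simp add: zero)
  next
    case (insert a F)
    then show ?case by (simp add: Pi_def carr add del: add_bit_eq_xor)
  qed
  then show ?thesis by (simp add: map_of_family_def)
qed

lemma monom_fun_indicator: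
  "monom_fun a (\<chi> i. of_bool (i \<in> c)) = of_bool (a \<subseteq> c)"
proof (cases "a \<subseteq> c")
  case True
  then show ?thesis by (auto simp: monom_fun_def intro!: prod.neutral)
next
  case False
  then show ?thesis by (auto simp: monom_fun_def intro!: prod_zero)
qed

text \<open>
  Triangularity: at the indicator vector of a minimal member \<open>c\<close> of \<open>F\<close>, the monomial of \<open>c\<close> is the
  only one with value \<open>1\<close>.
\<close>

lemma map_of_family_eq_zero:
  assumes "\<And>x. map_of_family F x = 0"
  shows "F = {}"
proof (rule ccontr)
  assume "F \<noteq> {}"
  then obtain c where c: "c \<in> F" "\<And>a. a \<in> F \<Longrightarrow> a \<subseteq> c \<Longrightarrow> a = c"
    using finite_has_minimal[of F] by (metis finite)
  have "(\<Sum>a\<in>F. monom_fun a (\<chi> i. of_bool (i \<in> c))) = (\<Sum>a\<in>F. if a = c then 1 else 0)"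
    by (rule sum.cong[OF refl]) (use c in \<open>auto simp: monom_fun_indicator\<close>)
  then show False
    using assms[of "\<chi> i. of_bool (i \<in> c)"] c(1) by (simp add: map_of_family_eq)
qed

lemma map_of_family_symm_diff:
  "map_of_family (F \<union> G - F \<inter> G) = (\<lambda>x. map_of_family F x + map_of_family G x)"
  by (rule ext) (simp add: map_of_family_eq sum_bit_symm_diff del: add_bit_eq_xor)

lemma inj_map_of_family: "inj map_of_family"
proof (rule injI)
  fix F G :: "'n::finite set set"
  assume eq: "map_of_family F = map_of_family G"
  have "F \<union> G - F \<inter> G = {}"
    by (rule map_of_family_eq_zero) (simp add: map_of_family_symm_diff eq)
  then show "F = G" by blast
qed

lemma card_set: "card (UNIV :: 'a::finite set set) = 2 ^ CARD('a)"
  by (simp add: card_Pow flip: Pow_UNIV)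

lemma UNIV_bit: "(UNIV :: bit set) = {0, 1}"
  by (auto intro: bit.exhaust)

lemma card_bit: "CARD(bit) = 2"
  by (simp add: UNIV_bit)

instance bit :: finite
  by standard (simp add: UNIV_bit)

lemma bij_map_of_family: "bij (map_of_family :: 'n::finite set set \<Rightarrow> _)"
proof -
  let ?M = "map_of_family :: 'n set set \<Rightarrow> _"
  have "CARD(bit ^ 'n \<Rightarrow> bit) = CARD('n set set)"
    by (simp add: card_set card_fun card_bit)
  also have "\<dots> = card (range ?M)"
    by (rule card_image[symmetric]) (rule inj_map_of_family)
  finally have "range ?M = UNIV"
    by (intro card_subset_eq) simp_all
  then show ?thesis
    using inj_map_of_family by (simp add: bij_def)
qed

text \<open>
  Over \<open>\<int>\<^sub>2\<close> the difference operator acts on squarefree monomials like the formal partial derivative: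
  with \<open>p\<close> the product of the other coordinates, \<open>(x\<^sub>i + 1) p + x\<^sub>i p = p\<close>.
\<close>

lemma partial_diff_monom_fun:
  fixes i :: "'n::finite"
  shows "partial_diff i (monom_fun b) = (\<lambda>x. if i \<in> b then monom_fun (b - {i}) x else 0)"
proof (rule ext)
  fix x :: "bit ^ 'n"
  have same: "(\<Prod>j\<in>c. (x + axis i 1) $ j) = (\<Prod>j\<in>c. x $ j)" if "i \<notin> c" for c
    by (rule prod.cong) (use that in \<open>auto simp: axis_def\<close>)
  have flip: "(x + axis i 1) $ i = x $ i + 1"
    by (simp add: axis_def)
  have double: "p + p = 0" for p :: bit
    by (cases p) simp_all
  have bit: "(t + 1) * p + t * p = p" for t p :: bit
    by (cases t; cases p) simp_all
  show "partial_diff i (monom_fun b) x = (if i \<in> b then monom_fun (b - {i}) x else 0)"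
  proof (cases "i \<in> b")
    case True
    then show ?thesis
      using bit[of "x $ i" "\<Prod>j\<in>b - {i}. x $ j"]
      by (simp add: partial_diff_def monom_fun_def prod.remove[of b i] same flip
          del: vector_add_component add_bit_eq_xor mult_bit_eq_and)
  next
    case False
    then show ?thesis by (simp add: partial_diff_def monom_fun_def same double
          del: vector_add_component add_bit_eq_xor)
  qed
qed

lemma partial_diffs_monom_fun:
  "partial_diffs c (monom_fun b) = (\<lambda>x. if c \<subseteq> b then monom_fun (b - c) x else 0)"
proof (induction c rule: finite_induct[OF finite])
  case (2 i c)
  have "partial_diff i (\<lambda>x. 0) = (\<lambda>x. 0)"
    by (simp add: partial_diff_def)
  moreover have "b - c - {i} = b - insert i c"
    by blast
  ultimately show ?case
    using 2 by (cases "c \<subseteq> b"; cases "i \<in> b")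
      (simp_all add: partial_diffs_insert partial_diff_monom_fun)
qed simp

section \<open>Endomorphisms as sums of normally ordered operators\<close>

lemma operator_of_eq:
  fixes A :: "('n::finite + 'n) set set"
  shows "operator_of A f x = (\<Sum>a\<in>A. monom_fun (Inl -` a) x * partial_diffs (Inr -` a) f x)"
proof -
  interpret algebra_module Z2 End_maps "maps_algebra :: (bit, bit ^ 'n \<Rightarrow> bit) module" "\<lambda>T f. T f"
    by (rule algebra_module_End_maps)
  let ?T = "\<lambda>a. monom_op (Inl -` a) \<otimes>\<^bsub>End_maps\<^esub> partial_diffs (Inr -` a)"
  have cl: "?T a \<in> carrier End_maps" for a :: "('n + 'n) set"
    by (intro A.m_closed monom_op_in_End partial_diffs_in_End)
  have app: "?T a f x = monom_fun (Inl -` a) x * partial_diffs (Inr -` a) f x" for a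
    by (simp add: endo_algebra_def monom_op_def maps_algebra_def compose_def)
  have add: "(S \<oplus>\<^bsub>End_maps\<^esub> T) f x = S f x + T f x" for S T
    by (simp add: endo_algebra_def maps_algebra_def)
  have zero: "\<zero>\<^bsub>End_maps\<^esub> f x = 0"
    by (simp add: endo_algebra_def maps_algebra_def)
  have "finite A" by simp
  then have "(\<Oplus>\<^bsub>End_maps\<^esub>a\<in>A. ?T a) f x = (\<Sum>a\<in>A. ?T a f x)"
  proof (induction A)
    case empty
    show ?case by (simp add: zero)
  next
    case (insert a A)
    then show ?case
      using cl by (simp add: Pi_def add del: add_bit_eq_xor)
  qed
  then show ?thesis by (simp only: operator_of_def app)
qed

lemma operator_of_in_End: "operator_of A \<in> carrier End_maps"
proof -
  interpret algebra_module Z2 End_maps "maps_algebra :: (bit, bit ^ 'n \<Rightarrow> bit) module" "\<lambda>T f. T f"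
    by (rule algebra_module_End_maps)
  show ?thesis unfolding operator_of_def
    by (intro A.finsum_closed Pi_I A.m_closed monom_op_in_End partial_diffs_in_End)
qed

lemma operator_of_symm_diff:
  "operator_of (A \<union> B - A \<inter> B) = (\<lambda>f x. operator_of A f x + operator_of B f x)"
  by (intro ext) (simp add: operator_of_eq sum_bit_symm_diff del: add_bit_eq_xor mult_bit_eq_and)

text \<open>
  Triangularity again, now in the derivative part: the minimal \<open>c\<close> makes the monomial of \<open>c\<close> kill every
  term except those differentiating by exactly \<open>c\<close>, and these turn it into the constant \<open>1\<close>. The kernel
  statement for functions then applies to the remaining multiplication parts.
\<close>

lemma operator_of_eq_zero:
  fixes A :: "('n::finite + 'n) set set"
  assumes zero: "\<And>f x. operator_of A f x = 0"
  shows "A = {}"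
proof (rule ccontr)
  assume "A \<noteq> {}"
  then obtain c where c: "c \<in> vimage Inr ` A" "\<And>a. a \<in> A \<Longrightarrow> Inr -` a \<subseteq> c \<Longrightarrow> Inr -` a = c"
    using finite_has_minimal[of "vimage Inr ` A"]
    by (metis (no_types, lifting) finite image_eqI image_is_empty)
  define B where "B = {a \<in> A. Inr -` a = c}"
  \<comment> \<open>Distinct members of \<open>B\<close> share their derivative part, so no two of their monomials cancel.\<close>
  have inj: "inj_on (vimage Inl) B"
  proof (rule inj_onI)
    fix a b assume "a \<in> B" "b \<in> B" and l: "Inl -` a = Inl -` b"
    then have r: "Inr -` a = Inr -` b" by (simp add: B_def)
    show "a = b"
    proof (rule Set.set_eqI)
      show "z \<in> a \<longleftrightarrow> z \<in> b" for z
        using l r by (cases z) (auto simp: set_eq_iff)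
    qed
  qed
  have one: "monom_fun {} x = 1" for x :: "bit ^ 'n"
    by (simp add: monom_fun_def)
  have "map_of_family (vimage Inl ` B) x = 0" for x
  proof -
    have "map_of_family (vimage Inl ` B) x = (\<Sum>a\<in>B. monom_fun (Inl -` a) x)"
      by (simp add: map_of_family_eq sum.reindex[OF inj])
    also have "\<dots> = (\<Sum>a\<in>A. monom_fun (Inl -` a) x * partial_diffs (Inr -` a) (monom_fun c) x)"
      by (rule sum.mono_neutral_cong_left)
        (use c(2) in \<open>auto simp: B_def partial_diffs_monom_fun one\<close>)
    also have "\<dots> = 0"
      using zero[of "monom_fun c" x] by (simp only: operator_of_eq)
    finally show ?thesis .
  qed
  then have "vimage Inl ` B = {}"
    by (rule map_of_family_eq_zero)
  with c(1) show False by (auto simp: B_def)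
qed

lemma inj_operator_of: "inj operator_of"
proof (rule injI)
  fix A B :: "('n::finite + 'n) set set"
  assume eq: "operator_of A = operator_of B"
  have "A \<union> B - A \<inter> B = {}"
    by (rule operator_of_eq_zero) (simp add: operator_of_symm_diff eq)
  then show "A = B" by blast
qed

text \<open>The monomials span all functions, so a linear map is determined by its values on them.\<close>

lemma End_maps_eqI:
  fixes S T :: "(bit ^ 'n::finite \<Rightarrow> bit) \<Rightarrow> bit ^ 'n \<Rightarrow> bit"
  assumes "S \<in> carrier End_maps" "T \<in> carrier End_maps"
    and "\<And>b. S (monom_fun b) = T (monom_fun b)"
  shows "S = T"
proof -
  have sum: "U (map_of_family F) x = (\<Sum>a\<in>F. U (monom_fun a) x)"
    if "U \<in> carrier End_maps" for U :: "(bit ^ 'n \<Rightarrow> bit) \<Rightarrow> bit ^ 'n \<Rightarrow> bit" and F x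
  proof -
    have add: "U (\<lambda>x. f x + g x) = (\<lambda>x. U f x + U g x)" for f g
      using that by (simp add: endo_algebra_def linear_maps_def maps_algebra_def)
    have zero: "U (\<lambda>x. 0) x = 0" for x
      using fun_cong[OF add[of "\<lambda>x. 0" "\<lambda>x. 0"], of x] by simp
    have "U (\<lambda>x. \<Sum>a\<in>F. monom_fun a x) x = (\<Sum>a\<in>F. U (monom_fun a) x)"
      by (induction F rule: finite_induct[OF finite])
        (simp_all add: add zero del: add_bit_eq_xor)
    then show ?thesis
      by (simp add: map_of_family_eq[abs_def])
  qed
  show ?thesis
  proof
    fix f :: "bit ^ 'n \<Rightarrow> bit"
    obtain F where "f = map_of_family F"
      using bij_map_of_family by (metis bij_pointE)
    then show "S f = T f"
      by (auto simp: sum[OF assms(1)] sum[OF assms(2)] assms(3))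
  qed
qed

text \<open>
  Restricting endomorphisms to the monomials bounds their number by that of the families \<open>A\<close>, which
  forces the injective map from families to endomorphisms to be onto.
\<close>

lemma bij_operator_of:
  "bij_betw (operator_of :: ('n::finite + 'n) set set \<Rightarrow> _) UNIV (carrier End_maps)"
proof -
  let ?E = "carrier End_maps :: ((bit ^ 'n \<Rightarrow> bit) \<Rightarrow> (bit ^ 'n \<Rightarrow> bit)) set"
  let ?O = "operator_of :: ('n + 'n) set set \<Rightarrow> _"
  have sub: "range ?O \<subseteq> ?E"
    using operator_of_in_End by auto
  have fin: "finite ?E" by simp
  have "card ?E = card ((\<lambda>T b. T (monom_fun b)) ` ?E)"
    by (intro card_image[symmetric] inj_onI End_maps_eqI) (auto dest: fun_cong)
  also have "\<dots> \<le> CARD('n set \<Rightarrow> bit ^ 'n \<Rightarrow> bit)"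
    by (intro card_mono) auto
  also have "\<dots> = CARD(('n + 'n) set set)"
    by (simp add: card_set card_fun card_bit power_add power_mult)
  also have "\<dots> = card (range ?O)"
    by (rule card_image[symmetric]) (rule inj_operator_of)
  finally have "range ?O = ?E"
    by (intro card_seteq fin sub)
  then show ?thesis
    using inj_operator_of by (simp add: bij_betw_def)
qed

lemma operator_of_linear: "operator_of \<in> linear_maps Z2 (PP_algebra prd u) End_maps"
proof -
  have zero: "operator_of {} = (\<lambda>f x. 0)"
    by (intro ext) (simp add: operator_of_eq)
  have add: "operator_of (A \<oplus>\<^bsub>PP_algebra prd u\<^esub> B) = operator_of A \<oplus>\<^bsub>End_maps\<^esub> operator_of B" for A B
    by (simp add: PP_algebra_def PP_space_def operator_of_symm_diff endo_algebra_def
        maps_algebra_def restrict_def del: add_bit_eq_xor)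
  have smult: "operator_of (k \<odot>\<^bsub>PP_algebra prd u\<^esub> A) = k \<odot>\<^bsub>End_maps\<^esub> operator_of A" for k A
    by (cases k) (simp_all add: PP_algebra_def PP_space_def zero endo_algebra_def
        maps_algebra_def restrict_def del: mult_bit_eq_and)
  show ?thesis
    unfolding linear_maps_def using operator_of_in_End add smult by blast
qed

lemma map_of_family_linear: "map_of_family \<in> linear_maps Z2 PP_space maps_algebra"
proof -
  have "map_of_family {} = (\<lambda>x. 0)"
    by (intro ext) (simp add: map_of_family_eq)
  then show ?thesis
    by (auto simp: linear_maps_def PP_space_def map_of_family_symm_diff maps_algebra_def
        del: add_bit_eq_xor mult_bit_eq_and)
qed

theorem theorem46:
  "\<exists>(prd :: ('n::finite + 'n) set set \<Rightarrow> ('n + 'n) set set \<Rightarrow> ('n + 'n) set set)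
     (act :: ('n + 'n) set set \<Rightarrow> 'n set set \<Rightarrow> 'n set set)
     (u :: ('n + 'n) set set).
       algebra_module Z2 (PP_algebra prd u) PP_space act \<and>
       pair_isomorphism Z2
         (PP_algebra prd u) PP_space act
         End_maps maps_algebra (\<lambda>T f. T f)
         operator_of map_of_family"
proof -
  interpret E: algebra_module Z2 End_maps "maps_algebra :: (bit, bit ^ 'n \<Rightarrow> bit) module" "\<lambda>T f. T f"
    by (rule algebra_module_End_maps)
  let ?O = "operator_of :: ('n + 'n) set set \<Rightarrow> _"
  let ?M = "map_of_family :: 'n set set \<Rightarrow> _"
  define prd where "prd A B = inv_into UNIV ?O (?O A \<otimes>\<^bsub>End_maps\<^esub> ?O B)" for A B
  define act where "act A F = inv_into UNIV ?M (?O A (?M F))" for A F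
  define u where "u = inv_into UNIV ?O \<one>\<^bsub>End_maps\<^esub>"
  have inv_O: "?O (inv_into UNIV ?O T) = T" if "T \<in> carrier End_maps" for T
    by (rule bij_betw_inv_into_right[OF bij_operator_of that])
  have prd: "?O (prd A B) = ?O A \<otimes>\<^bsub>End_maps\<^esub> ?O B" for A B
    unfolding prd_def by (intro inv_O E.A.m_closed operator_of_in_End)
  have u: "?O u = \<one>\<^bsub>End_maps\<^esub>"
    unfolding u_def by (intro inv_O E.A.one_closed)
  have act: "?M (act A F) = ?O A (?M F)" for A F
    unfolding act_def by (rule bij_betw_inv_into_right[OF bij_map_of_family UNIV_I])
  have carr: "carrier (PP_algebra prd u) = UNIV" "carrier (PP_space :: (bit, 'n set set) module) = UNIV"
    "carrier (maps_algebra :: (bit, bit ^ 'n \<Rightarrow> bit) module) = UNIV"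
    by (simp_all add: PP_algebra_def PP_space_def maps_algebra_def)
  have ops: "A \<otimes>\<^bsub>PP_algebra prd u\<^esub> B = prd A B" "\<one>\<^bsub>PP_algebra prd u\<^esub> = u" for A B
    by (simp_all add: PP_algebra_def)
  have alg: "algebra_module Z2 (PP_algebra prd u) PP_space act"
  proof (rule algebra_module_transport[OF algebra_module_End_maps, where f = ?O and g = ?M])
    show "module Z2 (PP_space :: (bit, 'n set set) module)"
      by (simp only: PP_space_eq module_PP_algebra)
  qed (simp_all add: module_PP_algebra operator_of_linear map_of_family_linear carr ops prd u act
      inj_operator_of inj_map_of_family)
  have "?O \<in> ring_hom (PP_algebra prd u) End_maps"
    using operator_of_linear[of prd u]
    by (intro ring_hom_memI) (auto simp: linear_maps_def carr ops prd u)
  then have "pair_isomorphism Z2 (PP_algebra prd u) PP_space act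
      End_maps maps_algebra (\<lambda>T f. T f) ?O ?M"
    unfolding pair_isomorphism_def pair_morphism_def carr
    by (simp add: operator_of_linear map_of_family_linear act bij_operator_of bij_map_of_family)
  with alg show ?thesis by blast
qed

end
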